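(* Let $G=(V,E)$ be an infinite, connected, locally finite graph, let $o\in V$, and let $\{X_t\}_{t\ge 0}$ be simple random walk on $G$ with $X_0=o$. Let $A\subset V$ be a set of vertices containing $o$, and let $T_A$ be the first exit time of the random walk from $A$. Let $p\in(0,1)$. Starting from the unit mass $\delta_o$ at $o$, the minimum number of toppling moves needed to transport mass $p$ to outside of $A$ satisfies $$N_p(G,A,\delta_o)\le (1-p)^{-1}\,\mathrm{Vol}(A)\cdot \mathbb{E}_o[T_A],$$ where $\mathrm{Vol}(A)=|A|$ is the number of vertices in $A$.
   Context: $T_A=\min\{t\ge 0: X_t\notin A\}$, and $\mathbb{E}_o$ denotes expectation for the walk started at $o$. The right-hand side is allowed to be $+\infty$. Toppling: write $y\sim v$ when $y,v$ are adjacent and $\mathcal{N}_v=\{y:y\sim v\}$. A mass distribution is a function $\mu:V\to[0,\infty)$. For a vertex $v$ with $\mu(v)>0$ and $0<m\le\mu(v)$, the toppling move $T_v^m$ topples mass $m$ at $v$ equally to its neighbours: $T_v^m\mu=\mu-m\delta_v+\frac{m}{|\mathcal{N}_v|}\sum_{y\sim v}\delta_y$. For $A\subset V$, $p>0$ and an initial mass distribution $\mu_0$, $N_p(G,A,\mu_0)$ is the minimum number of successive toppling moves needed to obtain from $\mu_0$ a mass distribution $\mu$ with $\sum_{v\notin A}\mu(v)\ge p$ (and $\infty$ if this is impossible). *)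

theory Defs
  imports "HOL-Probability.Probability" "Graph_Theory.Graph_Theory"
begin

text \<open>
  A simple undirected graph is a loop-free symmetric digraph without parallel arcs, i.e. a
  \<^typ>\<open>'v pair_pre_digraph\<close> satisfying \<^locale>\<open>pair_bidirected_digraph\<close>; it may be infinite.
\<close>

definition nbrs :: "'v pair_pre_digraph \<Rightarrow> 'v \<Rightarrow> 'v set" where
  "nbrs G v = {y. (y, v) \<in> parcs G}"

definition locally_finite_graph :: "'v pair_pre_digraph \<Rightarrow> bool" where
  "locally_finite_graph G \<longleftrightarrow> pair_bidirected_digraph G \<and> (\<forall>v\<in>pverts G. finite (nbrs G v))"


subsection \<open>Simple random walk\<close>

text \<open>
  The transition law conditions on the whole past, so it contains the Markov property. Any
  realization of the walk on any probability space is allowed.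
\<close>

locale simple_random_walk = prob_space M
  for M :: "'w measure" and G :: "'v pair_pre_digraph" and v\<^sub>0 :: 'v and X :: "nat \<Rightarrow> 'w \<Rightarrow> 'v" +
  assumes walk_measurable: "\<And>t. random_variable (count_space (pverts G)) (X t)"
    and walk_start: "AE \<omega> in M. X 0 \<omega> = v\<^sub>0"
    and walk_step: "\<And>t x y. \<P>(\<omega> in M. \<forall>i\<le>t. X i \<omega> = x i) > 0 \<Longrightarrow>
      \<P>(\<omega> in M. X (Suc t) \<omega> = y \<bar> \<forall>i\<le>t. X i \<omega> = x i) = pmf (pmf_of_set (nbrs G (x t))) y"

text \<open>The infimum of the empty set in \<^typ>\<open>enat\<close> is \<open>\<infinity>\<close> (the walk never leaves \<open>A\<close>).\<close>

definition exit_time :: "(nat \<Rightarrow> 'w \<Rightarrow> 'v) \<Rightarrow> 'v set \<Rightarrow> 'w \<Rightarrow> enat" where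
  "exit_time X A \<omega> = (INF t\<in>{t. X t \<omega> \<notin> A}. enat t)"

definition expected_exit_time :: "'w measure \<Rightarrow> (nat \<Rightarrow> 'w \<Rightarrow> 'v) \<Rightarrow> 'v set \<Rightarrow> ennreal" where
  "expected_exit_time M X A = (\<integral>\<^sup>+\<omega>. ennreal_of_enat (exit_time X A \<omega>) \<partial>M)"

text \<open>The number of vertices, equal to \<open>\<infinity>\<close> for infinite \<open>A\<close>.\<close>

definition vol :: "'v set \<Rightarrow> ennreal" where
  "vol A = emeasure (count_space UNIV) A"


subsection \<open>Toppling\<close>

text \<open>
  Mass distributions are functions on the vertex set; their values at points that are not
  vertices are irrelevant.
\<close>

definition mass_distribution :: "'v pair_pre_digraph \<Rightarrow> ('v \<Rightarrow> real) \<Rightarrow> bool" where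
  "mass_distribution G \<mu> \<longleftrightarrow> (\<forall>v\<in>pverts G. 0 \<le> \<mu> v)"

definition unit_mass :: "'v \<Rightarrow> 'v \<Rightarrow> real" where
  "unit_mass v = indicator {v}"

definition topple :: "'v pair_pre_digraph \<Rightarrow> 'v \<Rightarrow> real \<Rightarrow> ('v \<Rightarrow> real) \<Rightarrow> 'v \<Rightarrow> real" where
  "topple G v m \<mu> = (\<lambda>w. \<mu> w - m * unit_mass v w
     + m / real (card (nbrs G v)) * (\<Sum>y\<in>nbrs G v. unit_mass y w))"

definition toppling_move :: "'v pair_pre_digraph \<Rightarrow> ('v \<Rightarrow> real) \<Rightarrow> ('v \<Rightarrow> real) \<Rightarrow> bool" where
  "toppling_move G \<mu> \<mu>' \<longleftrightarrow> (\<exists>v\<in>pverts G. \<exists>m. 0 < m \<and> m \<le> \<mu> v \<and> \<mu>' = topple G v m \<mu>)"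

lemma toppling_move_mass_distribution:
  assumes "mass_distribution G \<mu>" "toppling_move G \<mu> \<mu>'"
  shows "mass_distribution G \<mu>'"
proof -
  obtain v m where v: "v \<in> pverts G" "0 < m" "m \<le> \<mu> v" "\<mu>' = topple G v m \<mu>"
    using assms(2) unfolding toppling_move_def by blast
  have "0 \<le> \<mu>' w" if "w \<in> pverts G" for w
  proof -
    have "0 \<le> \<mu> w - m * unit_mass v w"
      using assms(1) that v by (auto simp: mass_distribution_def unit_mass_def indicator_def)
    moreover have "0 \<le> m / real (card (nbrs G v)) * (\<Sum>y\<in>nbrs G v. unit_mass y w)"
      using v by (intro mult_nonneg_nonneg sum_nonneg) (auto simp: unit_mass_def)
    ultimately show ?thesis
      unfolding v(4) topple_def by linarith
  qed
  then show ?thesis by (simp add: mass_distribution_def)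
qed

text \<open>
  The mass outside \<open>A\<close> is a sum in \<^typ>\<open>ennreal\<close>, so it is meaningful for initial distributions of
  infinite support; the infimum over the empty set is \<open>\<infinity>\<close>.
\<close>

definition mass_outside :: "'v pair_pre_digraph \<Rightarrow> 'v set \<Rightarrow> ('v \<Rightarrow> real) \<Rightarrow> ennreal" where
  "mass_outside G A \<mu> = (\<Sum>\<^sub>\<infinity>v\<in>pverts G - A. ennreal (\<mu> v))"

definition toppling_number :: "real \<Rightarrow> 'v pair_pre_digraph \<Rightarrow> 'v set \<Rightarrow> ('v \<Rightarrow> real) \<Rightarrow> enat" where
  "toppling_number p G A \<mu>\<^sub>0 =
     (INF n\<in>{n. \<exists>\<mu>. (toppling_move G ^^ n) \<mu>\<^sub>0 \<mu> \<and> ennreal p \<le> mass_outside G A \<mu>}. enat n)"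

end

theory Submission
  imports Defs
begin

text \<open>
  Topple greedily: as long as less than \<open>p\<close> has left \<open>A\<close>, some vertex of \<open>A\<close> carries mass at least
  \<open>(1 - p) / |A|\<close>; topple all of it. Let \<open>h v\<close> be the expected exit time from \<open>A\<close> of the walk
  started at \<open>v\<close>, so that \<open>h = 1 +\<close> (average of \<open>h\<close> over the neighbours) on \<open>A\<close>. Toppling mass \<open>m\<close>
  inside \<open>A\<close> lowers the potential \<open>\<Sum>v. \<mu> v * h v\<close> by exactly \<open>m\<close>. The potential starts at \<open>h v\<^sub>0\<close> and
  stays nonnegative, so there are at most \<open>h v\<^sub>0 * |A| / (1 - p)\<close> moves.
\<close>

text \<open>Used with two weights: the constant 1 gives the total mass and
  \<open>mean_stay G A\<close> the potential. Values in \<open>ennreal\<close> let the sum always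
  exist; a vertex of mass 0 contributes 0 even where the weight is infinite.\<close>

definition weighted_mass :: "'v pair_pre_digraph \<Rightarrow> ('v \<Rightarrow> ennreal) \<Rightarrow> ('v \<Rightarrow> real) \<Rightarrow> ennreal" where
  "weighted_mass G w \<mu> = (\<Sum>\<^sub>\<infinity>u\<in>pverts G. ennreal (\<mu> u) * w u)"

definition nbr_avg :: "'v pair_pre_digraph \<Rightarrow> ('v \<Rightarrow> ennreal) \<Rightarrow> 'v \<Rightarrow> ennreal" where
  "nbr_avg G w v = ennreal (1 / real (card (nbrs G v))) * (\<Sum>y\<in>nbrs G v. w y)"

text \<open>The probability that the walk started at \<open>v\<close> is in \<open>A\<close> at all times \<open>0, \<dots>, t\<close>.\<close>

primrec stay_prob :: "'v pair_pre_digraph \<Rightarrow> 'v set \<Rightarrow> nat \<Rightarrow> 'v \<Rightarrow> real" where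
  "stay_prob G A 0 v = indicator A v"
| "stay_prob G A (Suc t) v =
     indicator A v * ((\<Sum>y\<in>nbrs G v. stay_prob G A t y) / real (card (nbrs G v)))"

text \<open>
  The function \<open>h\<close>. It is defined without the walk because the given walk starts at \<open>v\<^sub>0\<close> only, and
  it takes values in \<^typ>\<open>ennreal\<close> because it may be infinite at vertices the walk does not reach.
\<close>

definition mean_stay :: "'v pair_pre_digraph \<Rightarrow> 'v set \<Rightarrow> 'v \<Rightarrow> ennreal" where
  "mean_stay G A v = (\<Sum>t. ennreal (stay_prob G A t v))"

lemma summable_on_ennreal [simp]: "(f :: 'a \<Rightarrow> ennreal) summable_on S"
  by (rule nonneg_summable_on_complete) simp

section \<open>Neighbourhoods in an infinite connected graph\<close>

lemma nbrs_subset_pverts: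
  assumes "locally_finite_graph G"
  shows "nbrs G v \<subseteq> pverts G"
proof -
  interpret pair_bidirected_digraph G
    using assms by (simp add: locally_finite_graph_def)
  show ?thesis by (auto simp: nbrs_def dest: in_arcsD1)
qed

lemma finite_nbrs:
  "locally_finite_graph G \<Longrightarrow> v \<in> pverts G \<Longrightarrow> finite (nbrs G v)"
  by (simp add: locally_finite_graph_def)

text \<open>A path to any second vertex starts with an arc at \<open>v\<close>. Without neighbours,
  dividing by the degree 0 would yield 0 and toppled mass would vanish.\<close>

lemma nbrs_nonempty:
  assumes G: "locally_finite_graph G" and c: "Digraph_Component.connected (with_proj G)"
    and i: "infinite (pverts G)" and v: "v \<in> pverts G"
  shows "nbrs G v \<noteq> {}"
proof -
  interpret pair_bidirected_digraph G
    using G by (simp add: locally_finite_graph_def)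
  obtain w where w: "w \<in> pverts G" "w \<noteq> v"
    using i by (metis finite.emptyI finite_insert finite_subset insert_iff subsetI)
  have "strongly_connected (with_proj G)"
    using c sym_arcs by (rule symmetric_connected_imp_strongly_connected[rotated])
  then have "v \<rightarrow>\<^sup>*\<^bsub>with_proj G\<^esub> w"
    using v w(1) by (auto simp: strongly_connected_def)
  then obtain y where "(v, y) \<in> parcs G"
    using w(2) by (auto elim: converse_reachable_cases)
  then have "(y, v) \<in> parcs G"
    by (rule arcs_symmetric)
  then show ?thesis by (auto simp: nbrs_def)
qed

section \<open>Effect of a toppling on weighted masses\<close>

lemma sum_unit_mass:
  "finite S \<Longrightarrow> (\<Sum>y\<in>S. unit_mass y w) = indicator S w"
  by (simp add: unit_mass_def indicator_def)

lemma infsum_finite_support: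
  fixes f :: "'a \<Rightarrow> ennreal"
  assumes "finite F" "F \<subseteq> S" "\<And>x. x \<in> S - F \<Longrightarrow> f x = 0"
  shows "infsum f S = sum f F"
proof -
  have "infsum f S = infsum f F"
    using assms by (intro infsum_cong_neutral) auto
  then show ?thesis using assms(1) by simp
qed

text \<open>The balance holds vertex by vertex and is then summed. The loss at \<open>v\<close> is
  added on the left instead of subtracted on the right, because \<open>w\<close> may be
  infinite.\<close>

lemma weighted_mass_topple:
  assumes G: "locally_finite_graph G" and v: "v \<in> pverts G"
    and \<mu>: "mass_distribution G \<mu>" and m: "0 < m" "m \<le> \<mu> v"
  shows "weighted_mass G w (topple G v m \<mu>) + ennreal m * w v
       = weighted_mass G w \<mu> + ennreal m * nbr_avg G w v"
proof -
  let ?d = "real (card (nbrs G v))"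
  note fin = finite_nbrs[OF G v]
  have "mass_distribution G (topple G v m \<mu>)"
    using toppling_move_mass_distribution[OF \<mu>] v m unfolding toppling_move_def by blast
  then have pos: "0 \<le> topple G v m \<mu> u" "0 \<le> \<mu> u" if "u \<in> pverts G" for u
    using \<mu> that by (auto simp: mass_distribution_def)
  have *: "ennreal (topple G v m \<mu> u) * w u + ennreal (m * indicator {v} u) * w u
      = ennreal (\<mu> u) * w u + ennreal (m * (1 / ?d) * indicator (nbrs G v) u) * w u"
    if u: "u \<in> pverts G" for u
  proof -
    have "ennreal (topple G v m \<mu> u) + ennreal (m * indicator {v} u)
        = ennreal (topple G v m \<mu> u + m * indicator {v} u)"
      using pos[OF u] m by (intro ennreal_plus[symmetric]) auto
    also have "topple G v m \<mu> u + m * indicator {v} u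
        = \<mu> u + m * (1 / ?d) * indicator (nbrs G v) u"
      unfolding topple_def sum_unit_mass[OF fin] by (simp add: unit_mass_def)
    also have "ennreal \<dots> = ennreal (\<mu> u) + ennreal (m * (1 / ?d) * indicator (nbrs G v) u)"
      using pos[OF u] m by (intro ennreal_plus) auto
    finally show ?thesis by (metis distrib_right)
  qed
  have "weighted_mass G w (topple G v m \<mu>) + (\<Sum>\<^sub>\<infinity>u\<in>pverts G. ennreal (m * indicator {v} u) * w u)
     = weighted_mass G w \<mu>
       + (\<Sum>\<^sub>\<infinity>u\<in>pverts G. ennreal (m * (1 / ?d) * indicator (nbrs G v) u) * w u)"
    unfolding weighted_mass_def using *
    by (subst (1 2) infsum_add[symmetric]) (auto intro: infsum_cong)
  also have "(\<Sum>\<^sub>\<infinity>u\<in>pverts G. ennreal (m * indicator {v} u) * w u) = ennreal m * w v"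
    using v by (subst infsum_finite_support[of "{v}"]) auto
  also have "(\<Sum>\<^sub>\<infinity>u\<in>pverts G. ennreal (m * (1 / ?d) * indicator (nbrs G v) u) * w u)
      = (\<Sum>u\<in>nbrs G v. ennreal (m * (1 / ?d)) * w u)"
    using fin nbrs_subset_pverts[OF G]
    by (subst infsum_finite_support[of "nbrs G v"]) auto
  also have "\<dots> = ennreal m * nbr_avg G w v"
    using m by (simp only: nbr_avg_def sum_distrib_left[symmetric] mult.assoc[symmetric])
      (simp add: ennreal_mult[symmetric])
  finally show ?thesis .
qed

lemma nbr_avg_one:
  assumes "finite (nbrs G v)" "nbrs G v \<noteq> {}"
  shows "nbr_avg G (\<lambda>_. 1) v = 1"
proof -
  have "nbr_avg G (\<lambda>_. 1) v
      = ennreal (1 / real (card (nbrs G v))) * ennreal (real (card (nbrs G v)))"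
    by (simp add: nbr_avg_def ennreal_of_nat_eq_real_of_nat)
  also have "\<dots> = ennreal (1 / real (card (nbrs G v)) * real (card (nbrs G v)))"
    by (intro ennreal_mult[symmetric]) auto
  finally show ?thesis using assms by simp
qed

section \<open>The function \<open>mean_stay\<close> and its first-step equation\<close>

lemma stay_prob_nonneg: "0 \<le> stay_prob G A t v"
  by (induction t arbitrary: v) (auto intro!: sum_nonneg divide_nonneg_nonneg mult_nonneg_nonneg)

lemma stay_prob_notin: "v \<notin> A \<Longrightarrow> stay_prob G A t v = 0"
  by (cases t) auto

lemma mean_stay_eq:
  assumes "v \<in> A"
  shows "mean_stay G A v = 1 + nbr_avg G (mean_stay G A) v"
proof -
  let ?d = "real (card (nbrs G v))"
  \<comment> \<open>First-step analysis: the term at time 0 is the summand 1, and the shifted series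
    is averaged over the neighbours.\<close>
  have "mean_stay G A v
      = ennreal (stay_prob G A 0 v) + (\<Sum>t. ennreal (stay_prob G A (Suc t) v))"
    unfolding mean_stay_def by (subst suminf_offset[where i = 1]) auto
  also have "(\<lambda>t. ennreal (stay_prob G A (Suc t) v))
      = (\<lambda>t. ennreal (1 / ?d) * (\<Sum>y\<in>nbrs G v. ennreal (stay_prob G A t y)))"
    using assms
    by (simp add: sum_ennreal stay_prob_nonneg ennreal_mult[symmetric] sum_nonneg)
  also have "(\<Sum>t. ennreal (1 / ?d) * (\<Sum>y\<in>nbrs G v. ennreal (stay_prob G A t y)))
      = nbr_avg G (mean_stay G A) v"
    by (simp add: nbr_avg_def mean_stay_def suminf_sum)
  finally show ?thesis using assms by simp
qed

section \<open>Greedy toppling\<close>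

lemma large_mass_vertex:
  assumes A: "finite A" "A \<subseteq> pverts G" and \<mu>: "mass_distribution G \<mu>"
    and one: "weighted_mass G (\<lambda>_. 1) \<mu> = 1"
    and out: "mass_outside G A \<mu> < ennreal p" and p: "0 < p" "p < 1"
  obtains v where "v \<in> A" "(1 - p) / real (card A) \<le> \<mu> v"
proof -
  have nn: "0 \<le> \<mu> u" if "u \<in> A" for u
    using \<mu> A that by (auto simp: mass_distribution_def)
  have "pverts G = A \<union> (pverts G - A)" using A by auto
  then have "1 = (\<Sum>\<^sub>\<infinity>u\<in>A \<union> (pverts G - A). ennreal (\<mu> u))"
    using one by (simp add: weighted_mass_def)
  also have "\<dots> = (\<Sum>\<^sub>\<infinity>u\<in>A. ennreal (\<mu> u)) + mass_outside G A \<mu>"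
    unfolding mass_outside_def by (intro infsum_Un_disjoint) auto
  also have "(\<Sum>\<^sub>\<infinity>u\<in>A. ennreal (\<mu> u)) = ennreal (\<Sum>u\<in>A. \<mu> u)"
    using A nn by (simp add: sum_ennreal)
  finally have e: "1 = ennreal (\<Sum>u\<in>A. \<mu> u) + mass_outside G A \<mu>" .
  have "ennreal 1 \<le> ennreal (\<Sum>u\<in>A. \<mu> u) + ennreal p"
    unfolding ennreal_1 by (subst e) (intro add_left_mono less_imp_le out)
  then have "ennreal 1 \<le> ennreal ((\<Sum>u\<in>A. \<mu> u) + p)"
    using p nn by (simp add: ennreal_plus[symmetric] sum_nonneg del: ennreal_plus ennreal_1)
  then have le: "1 - p \<le> (\<Sum>u\<in>A. \<mu> u)"
    using p sum_nonneg[of A \<mu>, OF nn] by (subst (asm) ennreal_le_iff) auto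
  with p have ne: "A \<noteq> {}" by auto
  \<comment> \<open>Pigeonhole: otherwise the mass in \<open>A\<close> would be below
    \<open>1 - p\<close>.\<close>
  have "\<exists>v\<in>A. (1 - p) / real (card A) \<le> \<mu> v"
  proof (rule ccontr)
    assume "\<not> ?thesis"
    then have "(\<Sum>u\<in>A. \<mu> u) < (\<Sum>u\<in>A. (1 - p) / real (card A))"
      using A ne by (intro sum_strict_mono) (auto simp: not_le)
    with le ne A show False by simp
  qed
  then show thesis using that by blast
qed

text \<open>Induction along the greedy procedure. The bound on \<open>n\<close> keeps it running:
  before each further move, fewer than \<open>toppling_number\<close> moves were made, so less than
  \<open>p\<close> is outside. Conservation of total mass is carried along because the pigeonhole
  step needs it.\<close>

lemma greedy_toppling:
  assumes G: "locally_finite_graph G" "Digraph_Component.connected (with_proj G)"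
      "infinite (pverts G)"
    and A: "finite A" "A \<subseteq> pverts G" and v0: "v\<^sub>0 \<in> A" and p: "0 < p" "p < 1"
    and n: "enat n \<le> toppling_number p G A (unit_mass v\<^sub>0)"
  shows "\<exists>\<mu>. (toppling_move G ^^ n) (unit_mass v\<^sub>0) \<mu> \<and> mass_distribution G \<mu> \<and>
      weighted_mass G (\<lambda>_. 1) \<mu> = 1 \<and>
      weighted_mass G (mean_stay G A) \<mu> + of_nat n * ennreal ((1 - p) / real (card A))
        \<le> mean_stay G A v\<^sub>0"
  using n
proof (induction n)
  case 0
  have "weighted_mass G w (unit_mass v\<^sub>0) = w v\<^sub>0" for w
    unfolding weighted_mass_def using v0 A
    by (subst infsum_finite_support[of "{v\<^sub>0}"]) (auto simp: unit_mass_def)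
  then show ?case by (auto simp: mass_distribution_def unit_mass_def)
next
  case (Suc n)
  let ?c = "ennreal ((1 - p) / real (card A))"
  let ?N = "toppling_number p G A (unit_mass v\<^sub>0)"
  have "enat n < enat (Suc n)" by simp
  with Suc.prems have lt: "enat n < ?N" by (rule less_le_trans[rotated])
  with Suc.IH obtain \<mu> where \<mu>: "(toppling_move G ^^ n) (unit_mass v\<^sub>0) \<mu>" "mass_distribution G \<mu>"
    "weighted_mass G (\<lambda>_. 1) \<mu> = 1"
    and pot: "weighted_mass G (mean_stay G A) \<mu> + of_nat n * ?c \<le> mean_stay G A v\<^sub>0"
    by (auto simp: less_imp_le)
  \<comment> \<open>Otherwise \<open>n\<close> moves would suffice, against the minimality of
    \<open>?N\<close>.\<close>
  have "mass_outside G A \<mu> < ennreal p"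
  proof (rule ccontr)
    assume "\<not> ?thesis"
    then have "?N \<le> enat n"
      unfolding toppling_number_def using \<mu>(1) by (intro INF_lower) auto
    with lt show False by simp
  qed
  then obtain v where v: "v \<in> A" "(1 - p) / real (card A) \<le> \<mu> v"
    using large_mass_vertex[OF A \<mu>(2,3) _ p] by blast
  have "0 < real (card A)" using A v0 by (auto simp: card_gt_0_iff)
  with v p have pos: "0 < \<mu> v" by (smt (verit) divide_pos_pos)
  have vG: "v \<in> pverts G" using v A by auto
  let ?\<mu>' = "topple G v (\<mu> v) \<mu>"
  note top = weighted_mass_topple[OF G(1) vG \<mu>(2) pos order_refl]
  have move: "toppling_move G \<mu> ?\<mu>'"
    unfolding toppling_move_def using vG pos by blast
  have "weighted_mass G (\<lambda>_. 1) ?\<mu>' + ennreal (\<mu> v) = 1 + ennreal (\<mu> v)"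
    using top[of "\<lambda>_. 1"] \<mu>(3)
    by (simp add: nbr_avg_one finite_nbrs[OF G(1) vG] nbrs_nonempty[OF G vG])
  then have one: "weighted_mass G (\<lambda>_. 1) ?\<mu>' = 1"
    by (simp add: ennreal_add_left_cancel add.commute)
  let ?h = "mean_stay G A"
  \<comment> \<open>By the first-step equation, \<open>?h v\<close> is 1 plus the neighbour average;
    the 1 accounts for the drop by \<open>\<mu> v\<close>.\<close>
  have key: "weighted_mass G ?h ?\<mu>' + ennreal (\<mu> v) + ennreal (\<mu> v) * nbr_avg G ?h v
     = weighted_mass G ?h \<mu> + ennreal (\<mu> v) * nbr_avg G ?h v"
    using top[of ?h] mean_stay_eq[OF v(1), of G] by (simp add: algebra_simps)
  have "weighted_mass G ?h ?\<mu>' + of_nat (Suc n) * ?c \<le> ?h v\<^sub>0"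
  proof (cases "?h v\<^sub>0 = \<top>")
    case False
    \<comment> \<open>The potential at \<open>\<mu>\<close> is finite, so the averages can be cancelled in \<open>key\<close>.\<close>
    have "ennreal (\<mu> v) * nbr_avg G ?h v \<le> ennreal (\<mu> v) * ?h v"
      using mean_stay_eq[OF v(1), of G] by (intro mult_left_mono) auto
    also have "\<dots> = (\<Sum>\<^sub>\<infinity>u\<in>{v}. ennreal (\<mu> u) * ?h u)"
      by simp
    also have "\<dots> \<le> weighted_mass G ?h \<mu>"
      unfolding weighted_mass_def using vG by (intro infsum_mono_neutral) auto
    also have "\<dots> \<le> ?h v\<^sub>0"
      using pot by (rule order_trans[rotated]) simp
    finally have "ennreal (\<mu> v) * nbr_avg G ?h v \<noteq> \<top>"
      using False by (auto simp: top_unique)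
    with key have eq: "weighted_mass G ?h ?\<mu>' + ennreal (\<mu> v) = weighted_mass G ?h \<mu>"
      by (simp add: ennreal_add_left_cancel add.commute)
    have "weighted_mass G ?h ?\<mu>' + of_nat (Suc n) * ?c
        = weighted_mass G ?h ?\<mu>' + ?c + of_nat n * ?c"
      by (simp add: algebra_simps)
    also have "\<dots> \<le> weighted_mass G ?h ?\<mu>' + ennreal (\<mu> v) + of_nat n * ?c"
      using v by (intro add_mono ennreal_leI) auto
    also have "\<dots> \<le> ?h v\<^sub>0"
      using pot by (simp add: eq)
    finally show ?thesis .
  qed simp
  moreover have "(toppling_move G ^^ Suc n) (unit_mass v\<^sub>0) ?\<mu>'"
    using \<mu>(1) move by auto
  moreover have "mass_distribution G ?\<mu>'"
    using toppling_move_mass_distribution[OF \<mu>(2) move] .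
  ultimately show ?case using one by blast
qed

section \<open>Staying probabilities and the exit time of the given walk\<close>

context simple_random_walk
begin

lemma walk_sets [measurable]: "{\<omega> \<in> space M. X t \<omega> \<in> S} \<in> sets M"
proof -
  \<comment> \<open>Measurability refers to \<open>count_space (pverts G)\<close>, so
    \<open>S\<close> is cut down to the vertices; the walk takes no other values on
    \<open>space M\<close>.\<close>
  have "X t -` (S \<inter> pverts G) \<inter> space M \<in> sets M"
    using walk_measurable by (rule measurable_sets) auto
  also have "X t -` (S \<inter> pverts G) \<inter> space M = {\<omega> \<in> space M. X t \<omega> \<in> S}"
    using measurable_space[OF walk_measurable] by fastforce
  finally show ?thesis .
qed

lemma walk_eq_sets [measurable]: "{\<omega> \<in> space M. X t \<omega> = y} \<in> sets M"
  using walk_sets[of t "{y}"] by simp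

text \<open>The transition law in product form, which also covers histories of probability 0, where
  both sides vanish.\<close>

lemma prob_history_Suc:
  "\<P>(\<omega> in M. (\<forall>i\<le>n. X i \<omega> = x i) \<and> X (Suc n) \<omega> = y)
     = \<P>(\<omega> in M. \<forall>i\<le>n. X i \<omega> = x i) * pmf (pmf_of_set (nbrs G (x n))) y"
proof (cases "\<P>(\<omega> in M. \<forall>i\<le>n. X i \<omega> = x i) > 0")
  case True
  then show ?thesis
    using walk_step[OF True, of y] by (simp add: cond_prob_def field_simps conj_commute)
next
  case False
  then have 0: "\<P>(\<omega> in M. \<forall>i\<le>n. X i \<omega> = x i) = 0"
    by (simp add: zero_less_measure_iff)
  have "\<P>(\<omega> in M. (\<forall>i\<le>n. X i \<omega> = x i) \<and> X (Suc n) \<omega> = y) \<le> \<P>(\<omega> in M. \<forall>i\<le>n. X i \<omega> = x i)"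
    by (intro finite_measure_mono) auto
  with 0 show ?thesis by (simp add: measure_le_0_iff)
qed

text \<open>The walk cannot be restarted at \<open>x n\<close>, so the induction on \<open>t\<close>
  conditions on whole histories, with \<open>n\<close> and \<open>x\<close> arbitrary. The window
  \<open>{n..n+t}\<close> contains \<open>n\<close> itself, matching \<open>stay_prob\<close> at 0,
  the indicator of \<open>A\<close>.\<close>

lemma prob_stay:
  assumes A: "finite A" and nb: "\<And>v. v \<in> A \<Longrightarrow> finite (nbrs G v) \<and> nbrs G v \<noteq> {}"
  shows "\<P>(\<omega> in M. (\<forall>i\<le>n. X i \<omega> = x i) \<and> (\<forall>i\<in>{n..n+t}. X i \<omega> \<in> A))
       = \<P>(\<omega> in M. \<forall>i\<le>n. X i \<omega> = x i) * stay_prob G A t (x n)"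
proof (induction t arbitrary: n x)
  case 0
  show ?case
  proof (cases "x n \<in> A")
    case True
    then have "(\<forall>i\<le>n. X i \<omega> = x i) \<and> (\<forall>i\<in>{n..n+0}. X i \<omega> \<in> A) \<longleftrightarrow> (\<forall>i\<le>n. X i \<omega> = x i)" for \<omega>
      by auto
    with True show ?thesis by simp
  next
    case False
    then have "{\<omega> \<in> space M. (\<forall>i\<le>n. X i \<omega> = x i) \<and> (\<forall>i\<in>{n..n+0}. X i \<omega> \<in> A)} = {}"
      by auto
    with False show ?thesis by (simp only: stay_prob_notin) simp
  qed
next
  case (Suc t)
  let ?H = "\<P>(\<omega> in M. \<forall>i\<le>n. X i \<omega> = x i)"
  show ?case
  proof (cases "x n \<in> A")
    case True
    \<comment> \<open>Split by the next position \<open>y\<close>, appended to the history; staying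
      in \<open>A\<close> restricts \<open>y\<close> to the finite set \<open>A\<close>.\<close>
    let ?x = "\<lambda>y. x(Suc n := y)"
    let ?E = "\<lambda>y. {\<omega> \<in> space M. (\<forall>i\<le>Suc n. X i \<omega> = ?x y i) \<and> (\<forall>i\<in>{Suc n..Suc n+t}. X i \<omega> \<in> A)}"
    have hist: "(\<forall>i\<le>Suc n. X i \<omega> = ?x y i) \<longleftrightarrow> (\<forall>i\<le>n. X i \<omega> = x i) \<and> X (Suc n) \<omega> = y" for y \<omega>
      by (auto simp: le_Suc_eq)
    have "{n..n + Suc t} = insert n {Suc n..Suc n+t}" by auto
    then have "{\<omega> \<in> space M. (\<forall>i\<le>n. X i \<omega> = x i) \<and> (\<forall>i\<in>{n..n+Suc t}. X i \<omega> \<in> A)} = (\<Union>y\<in>A. ?E y)"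
      unfolding hist using True by auto
    then have "\<P>(\<omega> in M. (\<forall>i\<le>n. X i \<omega> = x i) \<and> (\<forall>i\<in>{n..n+Suc t}. X i \<omega> \<in> A))
        = measure M (\<Union>y\<in>A. ?E y)"
      by (rule arg_cong)
    also have "\<dots> = (\<Sum>y\<in>A. measure M (?E y))"
    proof (rule finite_measure_finite_Union[OF A])
      show "?E ` A \<subseteq> sets M"
        by (intro image_subsetI) measurable
      show "disjoint_family_on ?E A"
        unfolding hist by (auto simp: disjoint_family_on_def)
    qed
    also have "\<dots> = (\<Sum>y\<in>A. ?H * (pmf (pmf_of_set (nbrs G (x n))) y * stay_prob G A t y))"
      by (simp only: Suc.IH, simp only: hist prob_history_Suc) (simp add: mult.assoc)
    also have "\<dots> = ?H * (\<Sum>y\<in>A. pmf (pmf_of_set (nbrs G (x n))) y * stay_prob G A t y)"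
      by (simp add: sum_distrib_left)
    \<comment> \<open>Only \<open>y\<close> in both \<open>A\<close> and the neighbourhood count:
      the transition probability vanishes off the latter, \<open>stay_prob\<close> off the
      former.\<close>
    also have "(\<Sum>y\<in>A. pmf (pmf_of_set (nbrs G (x n))) y * stay_prob G A t y)
        = (\<Sum>y\<in>nbrs G (x n). stay_prob G A t y / real (card (nbrs G (x n))))"
      using nb[OF True] A
      by (intro sum.mono_neutral_cong) (auto simp: stay_prob_notin)
    also have "\<dots> = stay_prob G A (Suc t) (x n)"
      using True by (simp add: sum_divide_distrib)
    finally show ?thesis .
  next
    case False
    then have "{\<omega> \<in> space M. (\<forall>i\<le>n. X i \<omega> = x i) \<and> (\<forall>i\<in>{n..n+Suc t}. X i \<omega> \<in> A)} = {}"
      by (auto dest!: bspec[where x = n] intro!: exI[where x = n])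
    with False show ?thesis by (simp only: stay_prob_notin) simp
  qed
qed

text \<open>Tail-sum formula: the walk is in \<open>A\<close> throughout \<open>0, ..., t\<close>
  only if \<open>t\<close> is smaller than the exit time, so the indicators of these events sum to
  at most the exit time.\<close>

lemma suminf_prob_stay_le_expected_exit_time:
  "(\<Sum>t. emeasure M {\<omega> \<in> space M. \<forall>i\<le>t. X i \<omega> \<in> A}) \<le> expected_exit_time M X A"
proof -
  let ?E = "\<lambda>t. {\<omega> \<in> space M. \<forall>i\<le>t. X i \<omega> \<in> A}"
  have "(\<Sum>t. emeasure M (?E t)) = (\<Sum>t. \<integral>\<^sup>+\<omega>. indicator (?E t) \<omega> \<partial>M)"
    by simp
  also have "\<dots> = (\<integral>\<^sup>+\<omega>. (\<Sum>t. indicator (?E t) \<omega>) \<partial>M)"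
    by (rule nn_integral_suminf[symmetric]) measurable
  also have "\<dots> \<le> expected_exit_time M X A"
    unfolding expected_exit_time_def
  proof (rule nn_integral_mono)
    fix \<omega>
    show "(\<Sum>t. indicator (?E t) \<omega>) \<le> ennreal_of_enat (exit_time X A \<omega>)"
      unfolding exit_time_def
    proof (cases "{t. X t \<omega> \<notin> A} = {}")
      case False
      define k where "k = (LEAST t. X t \<omega> \<notin> A)"
      have k: "X k \<omega> \<notin> A" "k \<le> t" if "X t \<omega> \<notin> A" for t
        using LeastI[of "\<lambda>t. X t \<omega> \<notin> A"] Least_le[of "\<lambda>t. X t \<omega> \<notin> A"] that
        by (auto simp: k_def)
      have ex: "X k \<omega> \<notin> A" using False k by auto
      have "(INF t\<in>{t. X t \<omega> \<notin> A}. enat t) = enat k"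
        using k ex by (intro antisym INF_lower INF_greatest) auto
      moreover have "(\<Sum>t. indicator (?E t) \<omega> :: ennreal) = (\<Sum>t<k. indicator (?E t) \<omega>)"
        using ex by (intro suminf_finite) (auto simp: indicator_def not_less)
      moreover have "(\<Sum>t<k. indicator (?E t) \<omega> :: ennreal) \<le> (\<Sum>t<k. 1)"
        by (intro sum_mono) (auto simp: indicator_def)
      ultimately show "(\<Sum>t. indicator (?E t) \<omega>) \<le> ennreal_of_enat (INF t\<in>{t. X t \<omega> \<notin> A}. enat t)"
        by simp
    qed (simp add: top_enat_def)
  qed
  finally show ?thesis .
qed

lemma prob_start: "\<P>(\<omega> in M. X 0 \<omega> = v\<^sub>0) = 1"
  using walk_start by (subst prob_Collect_eq_1) auto

lemma mean_stay_le_expected_exit_time: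
  assumes A: "finite A" and nb: "\<And>v. v \<in> A \<Longrightarrow> finite (nbrs G v) \<and> nbrs G v \<noteq> {}"
  shows "mean_stay G A v\<^sub>0 \<le> expected_exit_time M X A"
proof -
  have "stay_prob G A t v\<^sub>0 \<le> \<P>(\<omega> in M. \<forall>i\<le>t. X i \<omega> \<in> A)" for t
  proof -
    \<comment> \<open>\<open>prob_stay\<close> for the history consisting of the start alone, which
      has probability 1.\<close>
    have "stay_prob G A t v\<^sub>0
        = \<P>(\<omega> in M. (\<forall>i\<le>0. X i \<omega> = v\<^sub>0) \<and> (\<forall>i\<in>{0..0+t}. X i \<omega> \<in> A))"
      using prob_stay[OF A nb, of 0 "\<lambda>_. v\<^sub>0" t] prob_start by simp
    also have "\<dots> \<le> \<P>(\<omega> in M. \<forall>i\<le>t. X i \<omega> \<in> A)"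
      by (intro finite_measure_mono) auto
    finally show ?thesis .
  qed
  then have "mean_stay G A v\<^sub>0 \<le> (\<Sum>t. emeasure M {\<omega> \<in> space M. \<forall>i\<le>t. X i \<omega> \<in> A})"
    unfolding mean_stay_def emeasure_eq_measure
    by (intro suminf_le ennreal_leI) auto
  also note suminf_prob_stay_le_expected_exit_time
  finally show ?thesis .
qed

text \<open>For infinite \<open>A\<close>, this excludes the product of infinity and 0 on the
  right-hand side of the theorem.\<close>

lemma expected_exit_time_ge_1:
  assumes "v\<^sub>0 \<in> A"
  shows "1 \<le> expected_exit_time M X A"
proof -
  let ?E = "\<lambda>t. {\<omega> \<in> space M. \<forall>i\<le>t. X i \<omega> \<in> A}"
  have "1 = \<P>(\<omega> in M. X 0 \<omega> = v\<^sub>0)" by (simp add: prob_start)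
  also have "\<dots> \<le> measure M (?E 0)"
    using assms by (intro finite_measure_mono) auto
  finally have "1 \<le> emeasure M (?E 0)"
    by (simp add: emeasure_eq_measure)
  also have "\<dots> = sum (\<lambda>t. emeasure M (?E t)) {0}" by simp
  also have "\<dots> \<le> (\<Sum>t. emeasure M (?E t))"
    by (rule sum_le_suminf) auto
  also note suminf_prob_stay_le_expected_exit_time
  finally show ?thesis .
qed

end

text \<open>Reduces a possibly infinite toppling number to the finite move counts treated by
  \<open>greedy_toppling\<close>; an infinite \<open>N\<close> forces \<open>c\<close> above every
  natural number.\<close>

lemma ennreal_of_enat_le_iff_all_nat:
  "ennreal_of_enat N \<le> c \<longleftrightarrow> (\<forall>n. enat n \<le> N \<longrightarrow> of_nat n \<le> c)"
proof
  assume *: "\<forall>n. enat n \<le> N \<longrightarrow> of_nat n \<le> c"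
  show "ennreal_of_enat N \<le> c"
  proof (cases N)
    case infinity
    with * have "(SUP n. of_nat n) \<le> c" by (intro SUP_least) auto
    then show ?thesis by (simp add: infinity ennreal_SUP_of_nat_eq_top)
  qed (use * in auto)
next
  assume "ennreal_of_enat N \<le> c"
  then show "\<forall>n. enat n \<le> N \<longrightarrow> of_nat n \<le> c"
    by (metis ennreal_of_enat_enat ennreal_of_enat_le_iff order_trans)
qed

theorem theorem1p3:
  fixes G :: "'v pair_pre_digraph" and v\<^sub>0 :: 'v and A :: "'v set"
    and M :: "'w measure" and X :: "nat \<Rightarrow> 'w \<Rightarrow> 'v" and p :: real
  assumes "locally_finite_graph G"
    and "Digraph_Component.connected (with_proj G)"
    and "infinite (pverts G)"
    and "v\<^sub>0 \<in> pverts G"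
    and "simple_random_walk M G v\<^sub>0 X"
    and "A \<subseteq> pverts G" and "v\<^sub>0 \<in> A"
    and "0 < p" and "p < 1"
  shows "ennreal_of_enat (toppling_number p G A (unit_mass v\<^sub>0))
           \<le> ennreal (inverse (1 - p)) * vol A * expected_exit_time M X A"
proof -
  interpret simple_random_walk M G v\<^sub>0 X by fact
  let ?E = "expected_exit_time M X A"
  show ?thesis
  proof (cases "finite A")
    case False
    moreover have "?E \<noteq> 0"
      using expected_exit_time_ge_1[OF \<open>v\<^sub>0 \<in> A\<close>] by auto
    ultimately show ?thesis
      using \<open>p < 1\<close> by (simp add: vol_def ennreal_mult_top ennreal_top_mult)
  next
    case True
    have card: "0 < real (card A)"
      using True \<open>v\<^sub>0 \<in> A\<close> by (auto simp: card_gt_0_iff)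
    have nb: "finite (nbrs G v) \<and> nbrs G v \<noteq> {}" if "v \<in> A" for v
      using that assms(6) finite_nbrs[OF assms(1)] nbrs_nonempty[OF assms(1-3)] by auto
    have "of_nat n \<le> ennreal (inverse (1 - p)) * vol A * ?E"
      if n: "enat n \<le> toppling_number p G A (unit_mass v\<^sub>0)" for n
    proof -
      \<comment> \<open>\<open>?c\<close> is the guaranteed potential drop per move and
        \<open>?d\<close> its reciprocal, so multiplying by \<open>?d\<close> isolates
        \<open>n\<close>.\<close>
      let ?c = "ennreal ((1 - p) / real (card A))"
      let ?d = "ennreal (inverse (1 - p)) * ennreal (real (card A))"
      obtain \<mu> where
        "weighted_mass G (mean_stay G A) \<mu> + of_nat n * ?c \<le> mean_stay G A v\<^sub>0"
        using greedy_toppling[OF assms(1-3) True assms(6-9) n] by blast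
      then have "of_nat n * ?c \<le> mean_stay G A v\<^sub>0"
        by (rule order_trans[rotated]) simp
      also have "\<dots> \<le> ?E"
        by (rule mean_stay_le_expected_exit_time[OF True nb])
      finally have "?d * (of_nat n * ?c) \<le> ?d * ?E"
        by (intro mult_left_mono) auto
      moreover have "?d * ?c = 1"
        using card \<open>p < 1\<close> by (simp add: ennreal_mult[symmetric] field_simps)
      then have "?d * (of_nat n * ?c) = of_nat n"
        by (metis mult.left_commute mult.right_neutral)
      ultimately show ?thesis
        using True by (simp add: vol_def ennreal_of_nat_eq_real_of_nat)
    qed
    then show ?thesis
      by (simp add: ennreal_of_enat_le_iff_all_nat)
  qed
qed

end
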